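(* For a connected chordal building set $\mathcal{B}$ on $[n]$, the $\gamma$-polynomial of the extended nestohedron $\mathcal{P}^{\square}(\mathcal{B})$ is $$\gamma_{\mathcal{P}^{\square}(\mathcal{B})}(t)=\sum_{w\in\widehat{\mathfrak{S}}_{n+1}\cap\mathfrak{S}^{\square}_{n+1}(\mathcal{B})}t^{\operatorname{des}(w)}.$$
   Context: A building set on $[n]$ is a collection $\mathcal{B}$ of nonempty subsets of $[n]$ containing all singletons and such that $I\cup J\in\mathcal{B}$ whenever $I,J\in\mathcal{B}$, $I\cap J\neq\varnothing$; it is connected if $[n]\in\mathcal{B}$, and chordal if for every $I=\{i_1<\dots<i_r\}\in\mathcal{B}$ and $s\in[r]$, $\{i_s,\dots,i_r\}\in\mathcal{B}$. For $Y\subseteq[n]$, $a,b\in Y$ lie in the same connected component of $\mathcal{B}|_Y=\{J\in\mathcal{B}:J\subseteq Y\}$ if some $J\in\mathcal{B}$, $J\subseteq Y$, contains both. A $\mathcal{B}$-partial permutation is a word $(a_1,\dots,a_k)$ of distinct elements of $[n]$ ($0\le k\le n$) such that for each $i\in[k]$, $a_i$ and $\max\{a_1,\dots,a_i\}$ lie in the same connected component of $\mathcal{B}|_{\{a_1,\dots,a_i\}}$. $\varphi_n(w)\in\mathfrak{S}_{n+1}$ is obtained by appending $[n+1]\setminus\{a_1,\dots,a_k\}$ to $w$ in decreasing order; $\mathfrak{S}^{\square}_{n+1}(\mathcal{B})$ is the set of all $\varphi_n(w)$. For $u\in\mathfrak{S}_{n+1}$, $\operatorname{des}(u)=|\{i\in[n]:u(i)>u(i+1)\}|$.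 $\widehat{\mathfrak{S}}_{n+1}$ is the set of $u\in\mathfrak{S}_{n+1}$ with no double descent (no $i$ with $u(i)>u(i+1)>u(i+2)$) and no final descent ($u(n)<u(n+1)$). An extended nested collection is a set $\{I_1,\dots,I_m,x_{i_1},\dots,x_{i_r}\}$ with $I_j\in\mathcal{B}$ and formal symbols $x_i$ ($i\in[n]$) such that the $I_j$ are pairwise nested or disjoint, no union of $k\ge2$ pairwise disjoint $I_j$'s lies in $\mathcal{B}$, and no $i_\ell$ lies in any $I_j$. $\mathcal{P}^{\square}(\mathcal{B})$ is an $n$-dimensional simple polytope with $f_i$ ($i$-faces) equal to the number of extended nested collections of cardinality $n-i$; $h$ is defined by $\sum_i f_it^i=h(t+1)$, and the $\gamma$-polynomial $\gamma(t)=\sum_i\gamma_it^i$ by $h(t)=\sum_{i=0}^{\lfloor n/2\rfloor}\gamma_it^i(1+t)^{n-2i}$. *)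

theory Defs
  imports
    "HOL-Analysis.Polytope"
    "HOL-Combinatorics.Multiset_Permutations"
    "HOL-Computational_Algebra.Polynomial"
begin

section \<open>Building sets\<close>

definition building_set :: "nat \<Rightarrow> nat set set \<Rightarrow> bool" where
  "building_set n \<B> \<longleftrightarrow>
     (\<forall>I\<in>\<B>. I \<noteq> {} \<and> I \<subseteq> {1..n}) \<and>
     (\<forall>i\<in>{1..n}. {i} \<in> \<B>) \<and>
     (\<forall>I\<in>\<B>. \<forall>J\<in>\<B>. I \<inter> J \<noteq> {} \<longrightarrow> I \<union> J \<in> \<B>)"

definition connected_building_set :: "nat \<Rightarrow> nat set set \<Rightarrow> bool" where
  "connected_building_set n \<B> \<longleftrightarrow> building_set n \<B> \<and> {1..n} \<in> \<B>"

definition chordal_building_set :: "nat \<Rightarrow> nat set set \<Rightarrow> bool" where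
  "chordal_building_set n \<B> \<longleftrightarrow> building_set n \<B> \<and> (\<forall>I\<in>\<B>. \<forall>i\<in>I. {j \<in> I. i \<le> j} \<in> \<B>)"

definition restriction :: "nat set set \<Rightarrow> nat set \<Rightarrow> nat set set" where
  "restriction \<B> Y = {J \<in> \<B>. J \<subseteq> Y}"

definition same_component :: "nat set set \<Rightarrow> nat set \<Rightarrow> nat \<Rightarrow> nat \<Rightarrow> bool" where
  "same_component \<B> Y a b \<longleftrightarrow> (\<exists>J \<in> restriction \<B> Y. a \<in> J \<and> b \<in> J)"


section \<open>Permutations\<close>

text \<open>
  Words and permutations in one-line notation are lists, which are indexed from 0: the value
  $u(i)$ is \<open>u ! (i - 1)\<close>.
\<close>

definition partial_permutation :: "nat \<Rightarrow> nat set set \<Rightarrow> nat list \<Rightarrow> bool" where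
  "partial_permutation n \<B> w \<longleftrightarrow>
     distinct w \<and> set w \<subseteq> {1..n} \<and>
     (\<forall>i < length w.
        let Y = set (take (Suc i) w) in same_component \<B> Y (w ! i) (Max Y))"

definition append_decreasing :: "nat \<Rightarrow> nat list \<Rightarrow> nat list" where
  "append_decreasing n w = w @ rev (sorted_list_of_set ({1..n + 1} - set w))"

definition extended_B_permutations :: "nat \<Rightarrow> nat set set \<Rightarrow> nat list set" where
  "extended_B_permutations n \<B> = append_decreasing n ` {w. partial_permutation n \<B> w}"

definition des :: "nat list \<Rightarrow> nat" where
  "des u = card {i. Suc i < length u \<and> u ! i > u ! Suc i}"

definition double_descent :: "nat list \<Rightarrow> bool" where
  "double_descent u \<longleftrightarrow>
     (\<exists>i. Suc (Suc i) < length u \<and> u ! i > u ! Suc i \<and> u ! Suc i > u ! Suc (Suc i))"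

definition final_descent :: "nat list \<Rightarrow> bool" where
  "final_descent u \<longleftrightarrow>
     length u \<ge> 2 \<and> u ! (length u - 2) > u ! (length u - 1)"

definition hat_permutations :: "nat \<Rightarrow> nat list set" where
  "hat_permutations m =
     {u \<in> permutations_of_set {1..m}. \<not> double_descent u \<and> \<not> final_descent u}"


section \<open>Extended nested collections\<close>

text \<open>\<open>Sym i\<close> is the formal symbol $x_i$.\<close>

datatype ext_element = Bset "nat set" | Sym nat

definition extended_nested_collection ::
    "nat \<Rightarrow> nat set set \<Rightarrow> ext_element set \<Rightarrow> bool" where
  "extended_nested_collection n \<B> N \<longleftrightarrow>
     (\<forall>I. Bset I \<in> N \<longrightarrow> I \<in> \<B>) \<and>
     (\<forall>i. Sym i \<in> N \<longrightarrow> i \<in> {1..n}) \<and>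
     (\<forall>I J. Bset I \<in> N \<and> Bset J \<in> N \<longrightarrow> I \<subseteq> J \<or> J \<subseteq> I \<or> I \<inter> J = {}) \<and>
     (\<forall>K. K \<subseteq> {I. Bset I \<in> N} \<and> finite K \<and> card K \<ge> 2 \<and> pairwise disjnt K
        \<longrightarrow> \<Union>K \<notin> \<B>) \<and>
     (\<forall>i I. Sym i \<in> N \<and> Bset I \<in> N \<longrightarrow> i \<notin> I)"

definition nested_f_vector :: "nat \<Rightarrow> nat set set \<Rightarrow> nat \<Rightarrow> nat" where
  "nested_f_vector n \<B> i = card {N. extended_nested_collection n \<B> N \<and> card N = n - i}"


section \<open>Extended nestohedra\<close>

definition face_number :: "'a::euclidean_space set \<Rightarrow> nat \<Rightarrow> nat" where
  "face_number P i = card {F. F face_of P \<and> aff_dim F = int i}"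

definition simple_polytope :: "nat \<Rightarrow> 'a::euclidean_space set \<Rightarrow> bool" where
  "simple_polytope d P \<longleftrightarrow>
     polytope P \<and> aff_dim P = int d \<and>
     (\<forall>v. v extreme_point_of P \<longrightarrow> card {F. F facet_of P \<and> v \<in> F} = d)"

text \<open>
  The extended nestohedron is determined by \<open>\<B>\<close> up to combinatorial equivalence: it is a simple
  polytope whose nonempty faces correspond, with inclusion reversed, to the extended nested
  collections, those of cardinality $n - i$ being the $i$-dimensional faces.
\<close>

definition is_extended_nestohedron ::
    "nat \<Rightarrow> nat set set \<Rightarrow> 'a::euclidean_space set \<Rightarrow> bool" where
  "is_extended_nestohedron n \<B> P \<longleftrightarrow>
     simple_polytope n P \<and>
     (\<exists>\<Phi>. bij_betw \<Phi> {N. extended_nested_collection n \<B> N} {F. F face_of P \<and> F \<noteq> {}} \<and>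
          (\<forall>M N. extended_nested_collection n \<B> M \<and> extended_nested_collection n \<B> N
             \<longrightarrow> (\<Phi> M \<subseteq> \<Phi> N \<longleftrightarrow> N \<subseteq> M)) \<and>
          (\<forall>N. extended_nested_collection n \<B> N \<longrightarrow> aff_dim (\<Phi> N) = int n - int (card N)))"


section \<open>The h-polynomial and the gamma-polynomial\<close>

definition f_polynomial :: "nat \<Rightarrow> (nat \<Rightarrow> nat) \<Rightarrow> int poly" where
  "f_polynomial d f = (\<Sum>i\<le>d. monom (int (f i)) i)"

text \<open>The defining relation is $f(t) = h(t + 1)$, that is $h(t) = f(t - 1)$.\<close>

definition h_polynomial :: "nat \<Rightarrow> (nat \<Rightarrow> nat) \<Rightarrow> int poly" where
  "h_polynomial d f = pcompose (f_polynomial d f) [:-1, 1:]"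

lemma h_polynomial_shift: "pcompose (h_polynomial d f) [:1, 1:] = f_polynomial d f"
proof -
  have "pcompose (h_polynomial d f) [:1, 1:] =
        pcompose (f_polynomial d f) (pcompose [:-1, 1:] [:1, 1:])"
    by (simp add: h_polynomial_def pcompose_assoc)
  also have "pcompose [:-1, 1:] [:1, 1:] = ([:0, 1:] :: int poly)"
    by (simp add: pcompose_pCons)
  finally show ?thesis by (simp add: pcompose_idR)
qed

definition gamma_expansion :: "nat \<Rightarrow> int poly \<Rightarrow> int poly" where
  "gamma_expansion d g =
     (\<Sum>i\<le>d div 2. smult (coeff g i) (monom 1 i * [:1, 1:] ^ (d - 2 * i)))"

text \<open>
  A polynomial has a gamma-polynomial only if it is palindromic, so this is a predicate rather
  than a function; there is at most one gamma-polynomial.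
\<close>

definition is_gamma_polynomial :: "nat \<Rightarrow> int poly \<Rightarrow> int poly \<Rightarrow> bool" where
  "is_gamma_polynomial d h g \<longleftrightarrow> degree g \<le> d div 2 \<and> h = gamma_expansion d g"

lemma gamma_expansion_eq_0D:
  assumes "gamma_expansion d g = 0" "i \<le> d div 2"
  shows "coeff g i = 0"
  using assms(2)
proof (induction i rule: less_induct)
  case (less i)
  have "0 = coeff (gamma_expansion d g) i" using assms(1) by simp
  also have "\<dots> = (\<Sum>j\<le>d div 2. coeff g j *
      (if i < j then 0 else coeff ([:1, 1:] ^ (d - 2 * j)) (i - j)))"
    unfolding gamma_expansion_def coeff_sum by (intro sum.cong) (auto simp: coeff_monom_mult)
  also have "\<dots> = (\<Sum>j\<le>d div 2. if j = i then coeff g i * coeff ([:1, 1:] ^ (d - 2 * i)) 0 else 0)"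
  proof (rule sum.cong)
    fix j assume "j \<in> {..d div 2}"
    then show "coeff g j * (if i < j then 0 else coeff ([:1, 1:] ^ (d - 2 * j)) (i - j)) =
        (if j = i then coeff g i * coeff ([:1, 1:] ^ (d - 2 * i)) 0 else 0)"
      using less.IH[of j] by (cases i j rule: linorder_cases) auto
  qed simp
  also have "\<dots> = coeff g i * coeff ([:1, 1:] ^ (d - 2 * i)) 0"
    using less.prems by simp
  also have "\<dots> = coeff g i" by (simp add: coeff_0_power)
  finally show ?case by simp
qed

lemma is_gamma_polynomial_unique:
  assumes "is_gamma_polynomial d h g" "is_gamma_polynomial d h g'"
  shows "g = g'"
proof -
  have "gamma_expansion d (g - g') = 0"
    using assms
    by (simp add: is_gamma_polynomial_def gamma_expansion_def smult_diff_left sum_subtractf)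
  then have "coeff g i = coeff g' i" if "i \<le> d div 2" for i
    using gamma_expansion_eq_0D[of d "g - g'" i] that by simp
  moreover have "coeff g i = coeff g' i" if "i > d div 2" for i
    using assms that by (simp add: is_gamma_polynomial_def coeff_eq_0)
  ultimately show ?thesis by (metis poly_eqI not_le)
qed

end

(*
  Extend both sides to polynomials in t indexed by the subsets Y of [n], the theorem being the case
  Y = [n]. Let C be the component of max(Y) in Y.

  A nested collection with union Y contains C, and deleting C leaves an arbitrary nested collection
  with union Y - b, where b is a nonempty subset of C. With [k] = 1 + t + ... + t^(k-1), this gives
      sum over b <= C of (-1)^|b| [|b| + 1] H(Y - b) = 0   (Y nonempty)
  for the h-polynomials H(Y), which determines them from H({}) = 1.

  The sum W(Y) of t^des (1 + t)^(|Y| - 2 des) over the B-partial permutations of Y without double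
  descent satisfies the same recursion. For a chordal building set, appending a decreasing word
  with letters b to a B-partial permutation of Y - b gives a B-partial permutation exactly if
  b <= C. For a fixed word of Y, the alternating sum over the ways to cut off a decreasing
  suffix cancels.
*)
theory Submission
  imports Defs
begin

section \<open>Weighted sums over subsets\<close>

lemma sum_Pow_binomial:
  fixes x y :: "'a::comm_ring_1"
  assumes "finite A"
  shows "(\<Sum>b\<in>Pow A. x ^ card b * y ^ (card A - card b)) = (x + y) ^ card A"
proof -
  have "(x + y) ^ card A = (\<Prod>a\<in>A. x + y)" by simp
  also have "\<dots> = (\<Sum>b\<in>Pow A. (\<Prod>a\<in>b. x) * (\<Prod>a\<in>A - b. y))"
    using assms by (rule prod_add)
  also have "\<dots> = (\<Sum>b\<in>Pow A. x ^ card b * y ^ (card A - card b))"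
    using assms by (intro sum.cong) (auto simp: card_Diff_subset finite_subset)
  finally show ?thesis by simp
qed

text \<open>In the notation of the overview this is \<open>(-1)^k [k+1]\<close>, the coefficient
  with which a deleted set of \<open>k\<close> elements enters the recursion.\<close>

definition run_coeff :: "'a::comm_ring_1 \<Rightarrow> nat \<Rightarrow> 'a" where
  "run_coeff t k = (-1) ^ k * (\<Sum>i\<le>k. t ^ i)"

lemma run_coeff_0 [simp]: "run_coeff t 0 = 1"
  by (simp add: run_coeff_def)

lemma run_coeff_1: "run_coeff t (Suc 0) = - (1 + t)"
  by (simp add: run_coeff_def)

text \<open>Up to the factor \<open>t - 1\<close>, \<open>run_coeff\<close> is a combination of the
  powers of -1 and -t, the roots of \<open>x^2 + (1 + t) x + t\<close>. The coefficients
  \<open>1 + t\<close> and \<open>t\<close> are also the weights of runs in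
  \<open>run_weight\<close>, which is what makes the sums over words cancel.\<close>

lemma run_coeff_recurrence:
  "run_coeff t (Suc (Suc m)) + (1 + t) * run_coeff t (Suc m) = - t * run_coeff t m"
  by (simp add: run_coeff_def algebra_simps)

lemma run_coeff_times: "(t - 1) * run_coeff t k = (-1) ^ k * (t ^ Suc k - 1)"
proof -
  have "(t - 1) * (\<Sum>i\<le>k. t ^ i) = t ^ Suc k - 1"
    by (induction k) (auto simp: algebra_simps)
  then show ?thesis by (metis run_coeff_def mult.left_commute)
qed

text \<open>The coefficients of the recursion for collections with a fixed support, all terms being
  moved to one side; see \<open>sum_nested_sum\<close>.\<close>

definition block_coeff :: "'a::comm_ring_1 \<Rightarrow> nat \<Rightarrow> 'a" where
  "block_coeff t k = (if k = 0 then 1 else - ((t - 1) ^ (k - 1)))"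

text \<open>The link between the recursion for extended collections and that for a fixed support.
  Multiplying by \<open>t - 1\<close> turns the sum into two binomial sums; cancelling this factor
  at the end requires \<open>t \<noteq> 1\<close> in a domain.\<close>

lemma sum_run_coeff:
  fixes t :: "'a::idom"
  assumes "finite A" "t \<noteq> 1"
  shows "(\<Sum>b\<in>Pow A. run_coeff t (card b) * t ^ (card A - card b)) = block_coeff t (card A)"
proof -
  have "(t - 1) * (\<Sum>b\<in>Pow A. run_coeff t (card b) * t ^ (card A - card b))
      = (\<Sum>b\<in>Pow A. t * ((-t) ^ card b * t ^ (card A - card b))
            - (-1) ^ card b * t ^ (card A - card b))"
    unfolding sum_distrib_left mult.assoc[symmetric] run_coeff_times
    by (rule sum.cong) (simp_all add: power_minus[of t] algebra_simps)
  also have "\<dots> = t * (-t + t) ^ card A - (-1 + t) ^ card A"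
    using sum_Pow_binomial[OF assms(1), of "-t" t] sum_Pow_binomial[OF assms(1), of "-1" t]
    by (simp only: sum_subtractf sum_distrib_left[symmetric])
  \<comment> \<open>The first power is zero unless \<open>A\<close> is empty, in which case
    \<open>0 ^ 0 = 1\<close> makes both sides equal to \<open>t - 1\<close>.\<close>
  also have "\<dots> = (t - 1) * block_coeff t (card A)"
    by (cases "card A") (auto simp: block_coeff_def algebra_simps)
  finally show ?thesis using assms(2) by simp
qed


section \<open>Words without double descents\<close>

text \<open>
  Words are read backwards, so that the last letter is the head of the list. A word without double
  descents gets the factor \<open>1 + t\<close> for every maximal decreasing run of length one and the factor
  \<open>t\<close> for every such run of length two.
\<close>

fun run_weight :: "'a::comm_ring_1 \<Rightarrow> nat list \<Rightarrow> 'a" where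
  "run_weight t [] = 1"
| "run_weight t [a] = 1 + t"
| "run_weight t (a # b # v) =
     (if b < a then (1 + t) * run_weight t (b # v)
      else if v = [] \<or> hd v < b then t * run_weight t v else 0)"

section \<open>Descents and double descents at the end of a word\<close>

lemma des_Nil [simp]: "des [] = 0" and des_single [simp]: "des [a] = 0"
  by (simp_all add: des_def)

lemma des_snoc: "des (xs @ [b, a]) = des (xs @ [b]) + (if a < b then 1 else 0)"
proof -
  have "{i. Suc i < length (xs @ [b, a]) \<and> (xs @ [b, a]) ! i > (xs @ [b, a]) ! Suc i}
     = {i. Suc i < length (xs @ [b]) \<and> (xs @ [b]) ! i > (xs @ [b]) ! Suc i}
        \<union> (if a < b then {length xs} else {})"
    by (auto simp: nth_append nth_Cons' split: if_splits)
  then show ?thesis by (auto simp: des_def card_insert_if)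
qed

lemma des_rev: "des (rev (a # b # v)) = des (rev (b # v)) + (if a < b then 1 else 0)"
  using des_snoc[of "rev v" b a] by simp

lemma double_descent_short [simp]:
  "\<not> double_descent []" "\<not> double_descent [a]" "\<not> double_descent [a, b]"
  by (auto simp: double_descent_def)

lemma double_descent_snoc:
  "double_descent (xs @ [c, b, a]) \<longleftrightarrow> double_descent (xs @ [c, b]) \<or> a < b \<and> b < c"
proof -
  have "Suc (Suc i) < length (xs @ [c, b, a]) \<and>
      (xs @ [c, b, a]) ! i > (xs @ [c, b, a]) ! Suc i \<and>
      (xs @ [c, b, a]) ! Suc i > (xs @ [c, b, a]) ! Suc (Suc i)
    \<longleftrightarrow> Suc (Suc i) < length (xs @ [c, b]) \<and>
      (xs @ [c, b]) ! i > (xs @ [c, b]) ! Suc i \<and> (xs @ [c, b]) ! Suc i > (xs @ [c, b]) ! Suc (Suc i)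
      \<or> i = length xs \<and> a < b \<and> b < c" for i
    by (auto simp: nth_append nth_Cons' split: if_splits)
  then show ?thesis
    unfolding double_descent_def by blast
qed

lemma double_descent_rev:
  "double_descent (rev (a # b # c # v)) \<longleftrightarrow> double_descent (rev (b # c # v)) \<or> a < b \<and> b < c"
  using double_descent_snoc[of "rev v" c b a] by simp

text \<open>Serves, with \<open>des_rev_larger\<close>, both for a last run of length one and for
  the letter \<open>Suc n\<close> that ends a full word after
  \<open>append_decreasing\<close>.\<close>

lemma double_descent_rev_larger:
  assumes "v \<noteq> [] \<Longrightarrow> hd v < m"
  shows "double_descent (rev (m # v)) \<longleftrightarrow> double_descent (rev v)"
  using assms
proof (cases v rule: remdups_adj.cases)
  case (3 x y xs)
  then show ?thesis using assms double_descent_rev[of m x y xs] by auto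
qed auto

lemma des_rev_larger:
  assumes "v \<noteq> [] \<Longrightarrow> hd v < m"
  shows "des (rev (m # v)) = des (rev v)"
proof (cases v)
  case (Cons a w)
  then show ?thesis using assms des_rev[of m a w] by auto
qed auto

text \<open>Without double descents every descent fills a run of length two, so
  \<open>length v - 2 * des (rev v)\<close> counts the runs of length one. The inequality is carried
  along because the subtraction is truncated.\<close>

lemma run_weight_eq:
  "distinct v \<Longrightarrow>
    (double_descent (rev v) \<longrightarrow> run_weight t v = 0) \<and>
    (\<not> double_descent (rev v) \<longrightarrow>
      2 * des (rev v) \<le> length v \<and>
      run_weight t v = t ^ des (rev v) * (1 + t) ^ (length v - 2 * des (rev v)))"
proof (induction t v rule: run_weight.induct)
  case (3 t a b v)
  \<comment> \<open>The last run of the word has length one, exactly two, or at least three.\<close>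
  consider "b < a" | "a < b" "v = [] \<or> hd v < b" | "a < b" "v \<noteq> []" "b < hd v"
    using "3.prems" by (cases v) (auto simp: neq_iff)
  then show ?case
  proof cases
    case 1
    then have "double_descent (rev (a # b # v)) \<longleftrightarrow> double_descent (rev (b # v))"
      "des (rev (a # b # v)) = des (rev (b # v))"
      using double_descent_rev_larger[of "b # v" a] des_rev_larger[of "b # v" a] by simp_all
    with 1 3 show ?thesis by (auto simp: Suc_diff_le simp del: rev.simps)
  next
    case 2
    have "double_descent (rev (a # b # v)) \<longleftrightarrow> double_descent (rev (b # v))"
      using 2 double_descent_rev[of a b] by (cases v) auto
    moreover have "double_descent (rev (b # v)) \<longleftrightarrow> double_descent (rev v)"
      "des (rev (b # v)) = des (rev v)"
      using 2 double_descent_rev_larger[of v b] des_rev_larger[of v b] by blast+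
    moreover have "des (rev (a # b # v)) = Suc (des (rev (b # v)))"
      using 2 des_rev[of a b v] by simp
    ultimately show ?thesis using 2 3 by (auto simp: mult_ac simp del: rev.simps)
  next
    case 3
    then show ?thesis by (cases v) (auto simp: double_descent_rev simp del: rev.simps)
  qed
qed auto

text \<open>In the backward reading these are the lengths of the decreasing suffixes that can be cut
  off a word.\<close>

definition inc_prefixes :: "nat list \<Rightarrow> nat set" where
  "inc_prefixes v = {k. k \<le> length v \<and> sorted_wrt (<) (take k v)}"

lemma finite_inc_prefixes [simp]: "finite (inc_prefixes v)"
  by (simp add: inc_prefixes_def)

lemma inc_prefixes_single: "inc_prefixes [a] = {0, Suc 0}"
  by (auto simp: inc_prefixes_def le_Suc_eq)

lemma inc_prefixes_Cons:
  assumes "a \<noteq> b"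
  shows "inc_prefixes (a # b # v) = (if a < b then insert 0 (Suc ` inc_prefixes (b # v)) else {0, Suc 0})"
proof (rule set_eqI)
  fix k
  show "k \<in> inc_prefixes (a # b # v)
    \<longleftrightarrow> k \<in> (if a < b then insert 0 (Suc ` inc_prefixes (b # v)) else {0, Suc 0})"
  proof (cases k)
    case (Suc j)
    show ?thesis
    proof (cases j)
      case (Suc i)
      then show ?thesis using \<open>k = Suc j\<close> assms
        by (auto simp: inc_prefixes_def image_iff dest: order.strict_trans)
    qed (use Suc in \<open>auto simp: inc_prefixes_def image_iff\<close>)
  qed (auto simp: inc_prefixes_def)
qed

text \<open>The shift \<open>m\<close> counts letters already cut off, so the terms beyond
  \<open>k = 0\<close> form the same sum for the rest of the word at \<open>m + 1\<close>. While the
  prefix can still grow, the recurrence cancels everything; at the end of a run only the lengths 0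
  and 1 are left.\<close>

lemma sum_inc_prefixes_shift:
  fixes t :: "'a::comm_ring_1"
  assumes "distinct (a # v)"
  shows "(\<Sum>k\<in>inc_prefixes (a # v). run_coeff t (m + k) * run_weight t (drop k (a # v)))
    = (if v \<noteq> [] \<and> a < hd v then 0
       else (run_coeff t (Suc m) + (1 + t) * run_coeff t m) * run_weight t v)"
  using assms
proof (induction v arbitrary: m a)
  case Nil
  then show ?case by (simp add: inc_prefixes_single algebra_simps)
next
  case (Cons b v)
  show ?case
  proof (cases "a < b")
    case True
    have "(\<Sum>k\<in>inc_prefixes (a # b # v). run_coeff t (m + k) * run_weight t (drop k (a # b # v)))
      = run_coeff t m * run_weight t (a # b # v) +
        (\<Sum>k\<in>inc_prefixes (b # v). run_coeff t (Suc m + k) * run_weight t (drop k (b # v)))"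
      using True by (simp add: inc_prefixes_Cons sum.reindex del: run_weight.simps)
    also have "(\<Sum>k\<in>inc_prefixes (b # v). run_coeff t (Suc m + k) * run_weight t (drop k (b # v)))
      = (if v \<noteq> [] \<and> b < hd v then 0 else - t * run_coeff t m * run_weight t v)"
      using Cons.prems by (subst Cons.IH) (simp_all add: run_coeff_recurrence)
    \<comment> \<open>If the run ends at \<open>b\<close>, the two terms are opposite multiples of
      \<open>t * run_weight t v\<close>; if it goes on, both are zero.\<close>
    also have "run_coeff t m * run_weight t (a # b # v) + \<dots> = 0"
      using True Cons.prems by (cases v) auto
    finally show ?thesis using True by simp
  next
    case False
    then show ?thesis using Cons.prems
      by (auto simp: inc_prefixes_Cons algebra_simps)
  qed
qed

text \<open>
  Only the three longest increasing prefixes leave a word without double descents, and their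
  coefficients cancel.
\<close>

lemma sum_inc_prefixes:
  fixes t :: "'a::comm_ring_1"
  assumes "distinct v" "v \<noteq> []"
  shows "(\<Sum>k\<in>inc_prefixes v. run_coeff t k * run_weight t (drop k v)) = 0"
proof (cases v)
  case (Cons a w)
  \<comment> \<open>At \<open>m = 0\<close> the second branch vanishes too, since
    \<open>run_coeff t 1 = - (1 + t)\<close> and \<open>run_coeff t 0 = 1\<close>.\<close>
  then show ?thesis
    using assms sum_inc_prefixes_shift[of a w t 0] by (auto simp: run_coeff_1)
qed (use assms in simp)


section \<open>The component of the maximum\<close>

definition top_component :: "nat set set \<Rightarrow> nat set \<Rightarrow> nat set" where
  "top_component \<B> Y = \<Union>{J \<in> restriction \<B> Y. Max Y \<in> J}"

lemma same_component_Max_iff: "same_component \<B> Y a (Max Y) \<longleftrightarrow> a \<in> top_component \<B> Y"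
  by (auto simp: same_component_def top_component_def)

lemma top_component_subset: "top_component \<B> Y \<subseteq> Y"
  by (auto simp: top_component_def restriction_def)

lemma subset_top_component: "J \<in> \<B> \<Longrightarrow> J \<subseteq> Y \<Longrightarrow> Max Y \<in> J \<Longrightarrow> J \<subseteq> top_component \<B> Y"
  by (auto simp: top_component_def restriction_def)

text \<open>The common element \<open>m\<close> makes each new member meet the union formed so
  far.\<close>

lemma building_set_Union:
  assumes "building_set n \<B>" "finite F" "F \<noteq> {}" "F \<subseteq> \<B>" "\<And>J. J \<in> F \<Longrightarrow> m \<in> J"
  shows "\<Union>F \<in> \<B>"
  using assms(2-)
proof (induction F rule: finite_ne_induct)
  case (insert J F)
  then have "\<Union>F \<in> \<B>" "J \<in> \<B>" "m \<in> J \<inter> \<Union>F" by auto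
  then show ?case using assms(1) unfolding building_set_def by (metis Union_insert empty_iff)
qed auto

context
  fixes n :: nat and \<B> :: "nat set set" and Y :: "nat set"
  assumes building: "building_set n \<B>" and Y: "Y \<subseteq> {1..n}" "Y \<noteq> {}"
begin

lemma Max_in_support: "Max Y \<in> Y"
  using Y finite_subset by (intro Max_in) auto

lemma Max_in_top_component: "Max Y \<in> top_component \<B> Y"
  using building Y Max_in_support subset_top_component[of "{Max Y}" \<B> Y]
  by (auto simp: building_set_def)

lemma top_component_in: "top_component \<B> Y \<in> \<B>"
  unfolding top_component_def
proof (rule building_set_Union[OF building])
  have "{J \<in> restriction \<B> Y. Max Y \<in> J} \<subseteq> Pow {1..n}" using Y by (auto simp: restriction_def)
  then show "finite {J \<in> restriction \<B> Y. Max Y \<in> J}" by (rule finite_subset) simp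
  show "{J \<in> restriction \<B> Y. Max Y \<in> J} \<noteq> {}"
    using Max_in_top_component by (auto simp: top_component_def)
qed (auto simp: restriction_def)

text \<open>Joining \<open>J\<close> to the top component gives a member of \<open>\<B>\<close>
  inside \<open>Y\<close> that contains the maximum, hence nothing new.\<close>

lemma top_component_absorbs:
  assumes "J \<in> \<B>" "J \<subseteq> Y" "J \<inter> top_component \<B> Y \<noteq> {}"
  shows "J \<subseteq> top_component \<B> Y"
proof -
  have "J \<union> top_component \<B> Y \<in> \<B>"
    using building assms top_component_in by (auto simp: building_set_def)
  then show ?thesis
    using subset_top_component[of "J \<union> top_component \<B> Y" \<B> Y] assms
      Max_in_top_component top_component_subset by blast
qed

text \<open>Allows the elements outside the component to vary while the component stays fixed, as
  \<open>sum_face_sum\<close> requires. The smaller set keeps the maximum and the component, and can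
  only have fewer members of \<open>\<B>\<close> inside it.\<close>

lemma top_component_restrict:
  assumes "Z \<subseteq> Y"
  shows "top_component \<B> (top_component \<B> Y \<union> Z) = top_component \<B> Y"
proof -
  let ?C = "top_component \<B> Y"
  have sub: "?C \<union> Z \<subseteq> Y" using assms top_component_subset by blast
  have "finite Y" using Y finite_subset by blast
  then have Max_eq: "Max (?C \<union> Z) = Max Y"
    using sub Max_in_top_component by (intro Max_eqI) (auto intro: finite_subset)
  show ?thesis
  proof
    show "?C \<subseteq> top_component \<B> (?C \<union> Z)"
      using Max_eq Max_in_top_component by (intro subset_top_component[OF top_component_in]) auto
    show "top_component \<B> (?C \<union> Z) \<subseteq> ?C"
      unfolding top_component_def[of _ "?C \<union> Z"] Max_eq
      using sub subset_top_component[of _ \<B> Y] unfolding restriction_def by blast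
  qed
qed

end


section \<open>The recursion for words\<close>

text \<open>Deleting the last letter leaves a word of the same kind, so the condition on all
  prefixes becomes a recursion on the reversed word.\<close>

fun rev_partial_permutation :: "nat set set \<Rightarrow> nat list \<Rightarrow> bool" where
  "rev_partial_permutation \<B> [] \<longleftrightarrow> True"
| "rev_partial_permutation \<B> (a # v) \<longleftrightarrow>
     a \<notin> set v \<and> a \<in> top_component \<B> (insert a (set v)) \<and> rev_partial_permutation \<B> v"

lemma rev_partial_permutation_distinct: "rev_partial_permutation \<B> v \<Longrightarrow> distinct v"
  by (induction v) auto

lemma partial_permutation_snoc:
  "partial_permutation n \<B> (w @ [a]) \<longleftrightarrow>
    partial_permutation n \<B> w \<and> a \<in> {1..n} \<and> a \<notin> set w \<and> a \<in> top_component \<B> (insert a (set w))"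
  by (auto simp: partial_permutation_def Let_def less_Suc_eq nth_append same_component_Max_iff)

lemma partial_permutation_iff:
  "partial_permutation n \<B> w \<longleftrightarrow> rev_partial_permutation \<B> (rev w) \<and> set w \<subseteq> {1..n}"
proof (induction w rule: rev_induct)
  case (snoc a w)
  then show ?case unfolding partial_permutation_snoc by auto
qed (auto simp: partial_permutation_def)

text \<open>
  Chordality puts the elements of \<open>xs\<close> in the component of the maximum at every intermediate
  stage: the part above \<open>y\<close> of the top component avoids the smaller, already removed letters.
\<close>

lemma rev_partial_permutation_append:
  assumes "chordal_building_set n \<B>" "sorted_wrt (<) xs" "set xs \<inter> set v = {}"
    "set xs \<union> set v \<subseteq> {1..n}"
  shows "rev_partial_permutation \<B> (xs @ v) \<longleftrightarrow>
    rev_partial_permutation \<B> v \<and> set xs \<subseteq> top_component \<B> (set xs \<union> set v)"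
  using assms(2-)
proof (induction xs)
  case (Cons x xs)
  have building: "building_set n \<B>" using assms(1) by (simp add: chordal_building_set_def)
  let ?Y' = "set xs \<union> set v"
  let ?Y = "insert x ?Y'"
  \<comment> \<open>The induction hypothesis refers to the component before \<open>x\<close> is
    added, the goal to the one afterwards.\<close>
  have "set xs \<subseteq> top_component \<B> ?Y' \<longleftrightarrow> set xs \<subseteq> top_component \<B> ?Y"
  proof (cases "xs = []")
    case False
    \<comment> \<open>The letter \<open>x\<close> lies below all of \<open>xs\<close>, so adding it
      does not move the maximum.\<close>
    then have Max_eq: "Max ?Y = Max ?Y'"
    proof -
      obtain y where y: "y \<in> set xs" using False by (cases xs) auto
      then have "x < y" "y \<le> Max ?Y'" using Cons.prems by auto
      then have "x \<le> Max ?Y'" by linarith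
      then show ?thesis using y by (subst Max_insert) auto
    qed
    show ?thesis
    proof
      assume "set xs \<subseteq> top_component \<B> ?Y'"
      then show "set xs \<subseteq> top_component \<B> ?Y"
        using Max_eq by (fastforce simp: top_component_def restriction_def)
    next
      assume sub: "set xs \<subseteq> top_component \<B> ?Y"
      show "set xs \<subseteq> top_component \<B> ?Y'"
      proof
        fix y assume y: "y \<in> set xs"
        let ?J = "{j \<in> top_component \<B> ?Y. y \<le> j}"
        have Y: "?Y \<subseteq> {1..n}" "?Y \<noteq> {}" using Cons.prems by auto
        have "?J \<in> \<B>"
          using top_component_in[OF building Y] y sub assms(1)
          unfolding chordal_building_set_def by blast
        moreover have "x < y" using Cons.prems(1) y by simp
        then have "?J \<subseteq> ?Y'" using top_component_subset[of \<B> ?Y] by auto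
        moreover have "Max ?Y' \<in> ?J"
          using Max_in_top_component[OF building Y] y unfolding Max_eq by auto
        ultimately have "?J \<subseteq> top_component \<B> ?Y'" by (rule subset_top_component)
        then show "y \<in> top_component \<B> ?Y'" using y sub by auto
      qed
    qed
  qed auto
  then show ?case using Cons by auto
qed auto

text \<open>This is \<open>W(Y)\<close> of the overview; words with double descents are present but
  have weight 0.\<close>

definition word_sum :: "nat set set \<Rightarrow> 'a::comm_ring_1 \<Rightarrow> nat set \<Rightarrow> 'a" where
  "word_sum \<B> t Y = (\<Sum>v | rev_partial_permutation \<B> v \<and> set v = Y. run_weight t v)"

lemma word_sum_empty: "word_sum \<B> t {} = 1"
proof -
  have "{v. rev_partial_permutation \<B> v \<and> set v = {}} = {[]}" by auto
  then show ?thesis by (simp add: word_sum_def)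
qed

lemma finite_rev_partial_permutations [simp]:
  "finite {v. rev_partial_permutation \<B> v \<and> set v = Y}"
  by (rule finite_subset[of _ "permutations_of_set Y"])
    (auto intro: permutations_of_setI rev_partial_permutation_distinct)

text \<open>A deleted set \<open>b\<close> with a word of \<open>Y - b\<close> is the same as a word
  of \<open>Y\<close> with a decreasing suffix marked for cutting. After this exchange the inner sum
  vanishes for each word of \<open>Y\<close> by \<open>sum_inc_prefixes\<close>.\<close>

lemma sum_word_sum:
  assumes "chordal_building_set n \<B>" "Y \<subseteq> {1..n}" "Y \<noteq> {}"
  shows "(\<Sum>b\<in>Pow (top_component \<B> Y). run_coeff t (card b) * word_sum \<B> t (Y - b)) = 0"
proof -
  define V where "V Z = {v. rev_partial_permutation \<B> v \<and> set v = Z}" for Z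
  have fin: "finite Y" using assms(2) by (rule finite_subset) simp
  have finV: "finite (V Z)" for Z
    by (simp add: V_def)
  have C: "top_component \<B> Y \<subseteq> Y" by (rule top_component_subset)
  have finC: "finite (top_component \<B> Y)" using C fin by (rule finite_subset)
  have "(\<Sum>b\<in>Pow (top_component \<B> Y). run_coeff t (card b) * word_sum \<B> t (Y - b))
     = (\<Sum>(b, v)\<in>Sigma (Pow (top_component \<B> Y)) (\<lambda>b. V (Y - b)).
          run_coeff t (card b) * run_weight t v)"
    unfolding word_sum_def sum_distrib_left V_def[symmetric]
    using finC finV by (subst sum.Sigma) auto
  also have "\<dots> = (\<Sum>(v, k)\<in>Sigma (V Y) inc_prefixes. run_coeff t k * run_weight t (drop k v))"
  \<comment> \<open>The letters of \<open>b\<close> have only one decreasing order, so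
    \<open>b\<close> and the length \<open>k\<close> of the marked suffix determine each other once
    the word is known.\<close>
  proof (rule sum.reindex_bij_witness[where
        i = "\<lambda>(v, k). (set (take k v), drop k v)" and
        j = "\<lambda>(b, v). (sorted_list_of_set b @ v, card b)"], goal_cases)
    case (1 p)
    then obtain b v where p: "p = (b, v)" "b \<subseteq> top_component \<B> Y" "v \<in> V (Y - b)"
      by (cases p) simp
    then have "finite b" using finC by (auto intro: finite_subset)
    then show ?case using p by simp
  next
    case (2 p)
    then obtain b v where p: "p = (b, v)" "b \<subseteq> top_component \<B> Y" "v \<in> V (Y - b)"
      by (cases p) simp
    then have b: "finite b" "b \<subseteq> Y" "b \<union> (Y - b) = Y"
      using C finC by (auto intro: finite_subset)
    have v: "set v = Y - b" "rev_partial_permutation \<B> v" using p by (auto simp: V_def)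
    have "rev_partial_permutation \<B> (sorted_list_of_set b @ v)"
      using p b v assms(2)
      by (subst rev_partial_permutation_append[OF assms(1)]) auto
    then show ?case using p b v by (auto simp: V_def inc_prefixes_def)
  next
    case (3 p)
    then obtain v k where p: "p = (v, k)" "v \<in> V Y" "k \<in> inc_prefixes v"
      by (cases p) simp
    then have k: "k \<le> length v" "sorted_wrt (<) (take k v)" by (auto simp: inc_prefixes_def)
    then have "sorted_list_of_set (set (take k v)) = take k v"
      by (simp add: sorted_list_of_set.idem_if_sorted_distinct strict_sorted_iff)
    moreover have "card (set (take k v)) = k"
      using k by (simp add: distinct_card strict_sorted_iff)
    ultimately show ?case using p by simp
  next
    case (4 p)
    then obtain v k where p: "p = (v, k)" "v \<in> V Y" "k \<in> inc_prefixes v"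
      by (cases p) simp
    then have k: "k \<le> length v" "sorted_wrt (<) (take k v)" by (auto simp: inc_prefixes_def)
    have v: "rev_partial_permutation \<B> (take k v @ drop k v)" "set (take k v @ drop k v) = Y"
      using p by (auto simp: V_def)
    then have disj: "set (take k v) \<inter> set (drop k v) = {}"
      using rev_partial_permutation_distinct[OF v(1)] unfolding distinct_append by (elim conjE)
    have un: "set (take k v) \<union> set (drop k v) = Y" using v(2) unfolding set_append .
    have "rev_partial_permutation \<B> (drop k v) \<and> set (take k v) \<subseteq> top_component \<B> Y"
      using rev_partial_permutation_append[OF assms(1) k(2) disj] v(1) assms(2) unfolding un by blast
    moreover have "set (drop k v) = Y - set (take k v)" using un disj by blast
    ultimately show ?case using p(1) by (simp add: V_def)
  next
    case (5 p)
    then obtain b v where p: "p = (b, v)" "b \<subseteq> top_component \<B> Y" "v \<in> V (Y - b)"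
      by (cases p) simp
    then have "finite b" using finC by (auto intro: finite_subset)
    then show ?case using p by simp
  qed
  also have "\<dots> = (\<Sum>v\<in>V Y. \<Sum>k\<in>inc_prefixes v. run_coeff t k * run_weight t (drop k v))"
    using finV by (subst sum.Sigma) auto
  also have "\<dots> = 0"
    using assms(3) rev_partial_permutation_distinct
    by (intro sum.neutral) (auto simp: V_def intro!: sum_inc_prefixes)
  finally show ?thesis .
qed


section \<open>The recursion for nested collections\<close>

text \<open>The union is prescribed so that the recursion can run over the support \<open>Y\<close>;
  symbols enter only through \<open>face_sum\<close>.\<close>

definition nested_on :: "nat set set \<Rightarrow> nat set \<Rightarrow> nat set set \<Rightarrow> bool" where
  "nested_on \<B> Y M \<longleftrightarrow> M \<subseteq> \<B> \<and> \<Union>M = Y \<and>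
     (\<forall>I\<in>M. \<forall>J\<in>M. I \<subseteq> J \<or> J \<subseteq> I \<or> I \<inter> J = {}) \<and>
     (\<forall>K\<subseteq>M. finite K \<and> card K \<ge> 2 \<and> pairwise disjnt K \<longrightarrow> \<Union>K \<notin> \<B>)"

lemma nested_on_finite:
  assumes "nested_on \<B> Y M" "finite Y"
  shows "finite M"
  by (rule finite_subset[of _ "Pow Y"]) (use assms in \<open>auto simp: nested_on_def\<close>)

lemma finite_nested_on [simp]:
  assumes "finite Y"
  shows "finite {M. nested_on \<B> Y M}"
  by (rule finite_subset[of _ "Pow (Pow Y)"]) (use assms in \<open>auto simp: nested_on_def\<close>)

lemma nested_on_subset:
  assumes "nested_on \<B> Y M" "M' \<subseteq> M" "\<Union>M' = Y'"
  shows "nested_on \<B> Y' M'"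
  unfolding nested_on_def
proof (intro conjI ballI allI impI)
  fix K assume "K \<subseteq> M'" "finite K \<and> 2 \<le> card K \<and> pairwise disjnt K"
  moreover from this have "K \<subseteq> M" using assms(2) by order
  ultimately show "\<Union>K \<notin> \<B>" using assms(1) unfolding nested_on_def by simp
next
  fix I J assume "I \<in> M'" "J \<in> M'"
  then have "I \<in> M" "J \<in> M" using assms(2) by auto
  then show "I \<subseteq> J \<or> J \<subseteq> I \<or> I \<inter> J = {}" using assms(1) unfolding nested_on_def by simp
qed (use assms in \<open>auto simp: nested_on_def\<close>)

text \<open>The maximal members of \<open>F\<close> are disjoint, so there is only one of them.\<close>

lemma nested_on_Union_mem:
  assumes "nested_on \<B> Y M" "F \<subseteq> M" "finite F" "\<Union>F \<in> \<B>" "\<Union>F \<noteq> {}"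
  shows "\<Union>F \<in> F"
proof -
  define K where "K = {J \<in> F. \<forall>I\<in>F. J \<subseteq> I \<longrightarrow> I = J}"
  have K: "K \<subseteq> F" "finite K" using assms(3) by (auto simp: K_def)
  have "\<exists>I\<in>K. J \<subseteq> I" if "J \<in> F" for J
    using finite_has_maximal2[OF assms(3) that] by (auto simp: K_def)
  then have Union_K: "\<Union>K = \<Union>F" using K(1) by fast
  have "pairwise disjnt K"
  proof (rule pairwiseI)
    fix I J assume "I \<in> K" "J \<in> K" "I \<noteq> J"
    moreover from this have "I \<in> M" "J \<in> M" using K(1) assms(2) by auto
    then have "I \<subseteq> J \<or> J \<subseteq> I \<or> I \<inter> J = {}" using assms(1) by (simp add: nested_on_def)
    ultimately show "disjnt I J" by (auto simp: K_def disjnt_def)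
  qed
  moreover have "K \<subseteq> M" using K(1) assms(2) by order
  ultimately have "\<not> card K \<ge> 2"
    using assms(1,4) K(2) Union_K by (auto simp: nested_on_def)
  moreover have "card K \<noteq> 0" using assms(5) Union_K K(2) by auto
  ultimately have "card K = 1" by linarith
  then obtain J where "K = {J}" by (rule card_1_singletonE)
  then show ?thesis using Union_K K(1) by auto
qed

section \<open>Removing and inserting the top component of the support\<close>

context
  fixes n :: nat and \<B> :: "nat set set" and Y C :: "nat set"
  assumes building: "building_set n \<B>" and Y: "Y \<subseteq> {1..n}" "Y \<noteq> {}"
  defines "C \<equiv> top_component \<B> Y"
begin

lemma finite_support: "finite Y"
  using Y(1) by (rule finite_subset) simp

lemma C_mem: "C \<in> \<B>"
  unfolding C_def by (rule top_component_in[OF building Y])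

lemma C_sub: "C \<subseteq> Y"
  unfolding C_def by (rule top_component_subset)

lemma C_nonempty: "C \<noteq> {}"
  unfolding C_def using Max_in_top_component[OF building Y] by blast

lemma C_absorbs: "J \<in> \<B> \<Longrightarrow> J \<subseteq> Y \<Longrightarrow> J \<inter> C \<noteq> {} \<Longrightarrow> J \<subseteq> C"
  unfolding C_def by (rule top_component_absorbs[OF building Y])

text \<open>The members of \<open>F\<close> that meet \<open>C\<close> lie inside it by absorption,
  so their union is \<open>C\<close>, and \<open>nested_on_Union_mem\<close> applies. With
  \<open>F = M\<close> this puts \<open>C\<close> into \<open>M\<close>; with
  \<open>F = M - {C}\<close> it shows that the other members cannot cover \<open>C\<close>.\<close>

lemma C_mem_of_cover:
  assumes "nested_on \<B> Y M" "F \<subseteq> M" "C \<subseteq> \<Union>F"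
  shows "C \<in> F"
proof -
  let ?F = "{J \<in> F. J \<inter> C \<noteq> {}}"
  have "J \<subseteq> C" if "J \<in> ?F" for J
  proof (rule C_absorbs)
    have "J \<in> M" "M \<subseteq> \<B>" "\<Union>M = Y" using that assms(1,2) by (auto simp: nested_on_def)
    then show "J \<in> \<B>" "J \<subseteq> Y" by auto
  qed (use that in simp)
  then have "\<Union>?F = C" using assms(3) by fast
  moreover have "finite ?F"
    using nested_on_finite[OF assms(1) finite_support] assms(2) by (auto intro: finite_subset)
  moreover have "?F \<subseteq> M" using assms(2) by blast
  ultimately have "C \<in> ?F"
    using nested_on_Union_mem[OF assms(1), of ?F] C_mem C_nonempty by simp
  then show ?thesis by blast
qed

lemma top_component_mem_nested:
  assumes "nested_on \<B> Y M"
  shows "C \<in> M"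
proof (rule C_mem_of_cover[OF assms order_refl])
  show "C \<subseteq> \<Union>M" using assms C_sub by (simp add: nested_on_def)
qed

text \<open>Here \<open>b\<close> consists of the elements covered by \<open>C\<close> alone, which
  are exactly those lost from the support.\<close>

lemma nested_on_remove:
  assumes "nested_on \<B> Y M"
  defines "b \<equiv> C - \<Union>(M - {C})"
  shows "b \<noteq> {}" "\<Union>(M - {C}) = Y - b" "nested_on \<B> (Y - b) (M - {C})"
proof -
  show "b \<noteq> {}"
    using C_mem_of_cover[OF assms(1), of "M - {C}"] unfolding b_def by blast
  have "\<Union>M = Y" using assms(1) by (simp add: nested_on_def)
  then show "\<Union>(M - {C}) = Y - b"
    using top_component_mem_nested[OF assms(1)] unfolding b_def by blast
  then show "nested_on \<B> (Y - b) (M - {C})"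
    by (rule nested_on_subset[OF assms(1) Diff_subset])
qed

text \<open>The inverse of \<open>nested_on_remove\<close>. By absorption \<open>C\<close> is
  comparable to or disjoint from each member of \<open>M\<close>, so only disjoint families through
  \<open>C\<close> need an argument.\<close>

lemma nested_on_insert:
  assumes "b \<subseteq> C" "b \<noteq> {}" "nested_on \<B> (Y - b) M"
  shows "C \<notin> M" "C - \<Union>M = b" "nested_on \<B> Y (insert C M)"
proof -
  have M: "M \<subseteq> \<B>" "\<Union>M = Y - b" using assms(3) by (auto simp: nested_on_def)
  show "C \<notin> M" using M assms by blast
  show "C - \<Union>M = b" using M assms C_sub by blast
  have absorb: "J \<subseteq> C \<or> J \<inter> C = {}" if "J \<in> M" for J
    using C_absorbs[of J] M that by blast
  have unions: "\<Union>K \<notin> \<B>"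
    if K: "K \<subseteq> insert C M" "finite K" "card K \<ge> 2" "pairwise disjnt K" for K
  proof (cases "C \<in> K")
    case True
    have "K \<noteq> {C}" using K(3) by auto
    then obtain J where J: "J \<in> K" "J \<noteq> C" using True by blast
    then have "J \<inter> C = {}" using True K(4) by (auto simp: pairwise_def disjnt_def)
    moreover have "J \<noteq> {}" using J K(1) M(1) building by (auto simp: building_set_def)
    ultimately have "\<not> \<Union>K \<subseteq> C" using J by blast
    moreover have "\<Union>K \<subseteq> Y" using K(1) M(2) C_sub by blast
    \<comment> \<open>If \<open>\<Union>K\<close> were in \<open>\<B>\<close>, then, meeting
      \<open>C\<close>, it would lie inside \<open>C\<close>, but \<open>J\<close> is nonempty and
      disjoint from \<open>C\<close>.\<close>
    ultimately show ?thesis using C_absorbs[of "\<Union>K"] True C_nonempty by blast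
  next
    case False
    then have "K \<subseteq> M" using K(1) by blast
    then show ?thesis using K assms(3) by (simp add: nested_on_def)
  qed
  have cover: "\<Union>(insert C M) = Y" using M assms(1) C_sub by auto
  have nested: "I \<subseteq> J \<or> J \<subseteq> I \<or> I \<inter> J = {}" if "I \<in> M" "J \<in> M" for I J
    using that assms(3) by (simp add: nested_on_def)
  have "I \<subseteq> J \<or> J \<subseteq> I \<or> I \<inter> J = {}" if "I \<in> insert C M" "J \<in> insert C M" for I J
    using that absorb nested by (elim insertE) (metis order_refl Int_commute)+
  then show "nested_on \<B> Y (insert C M)"
    using C_mem M(1) unions cover unfolding nested_on_def by simp
qed

end

lemma nested_on_empty_iff:
  assumes "building_set n \<B>"
  shows "nested_on \<B> {} M \<longleftrightarrow> M = {}"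
proof
  assume "nested_on \<B> {} M"
  then have "M \<subseteq> \<B>" "M \<subseteq> {{}}" by (auto simp: nested_on_def)
  moreover have "{} \<notin> \<B>" using assms by (auto simp: building_set_def)
  ultimately show "M = {}" by blast
next
  assume "M = {}"
  then show "nested_on \<B> {} M" by (auto simp: nested_on_def)
qed

text \<open>Each removal of the top component costs the support at least one element. The bound
  ensures that the exponents \<open>card Y - card M\<close> are not truncated.\<close>

lemma nested_on_card_le:
  assumes "building_set n \<B>" "Y \<subseteq> {1..n}" "nested_on \<B> Y M"
  shows "card M \<le> card Y"
proof -
  have "finite Y" using assms(2) by (rule finite_subset) simp
  then show ?thesis using assms(2,3)
  proof (induction Y arbitrary: M rule: finite_psubset_induct)
    case (psubset Y)
    show ?case
    proof (cases "Y = {}")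
      case True
      then show ?thesis using psubset.prems nested_on_empty_iff[OF assms(1)] by simp
    next
      case False
      let ?C = "top_component \<B> Y"
      define b where "b = ?C - \<Union>(M - {?C})"
      note remove = nested_on_remove[OF assms(1) psubset.prems(1) False psubset.prems(2), folded b_def]
      have "?C \<in> M"
        by (rule top_component_mem_nested[OF assms(1) psubset.prems(1) False psubset.prems(2)])
      moreover have "finite M" by (rule nested_on_finite[OF psubset.prems(2) psubset.hyps(1)])
      ultimately have M: "card M = Suc (card (M - {?C}))" by (intro card.remove)
      have "b \<subseteq> Y" using top_component_subset[of \<B> Y] by (auto simp: b_def)
      then have less: "Y - b \<subset> Y" using remove(1) by blast
      have "Y - b \<subseteq> {1..n}" using psubset.prems(1) by blast
      then have "card (M - {?C}) \<le> card (Y - b)" using psubset.IH[OF less _ remove(3)] by simp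
      moreover have "card (Y - b) < card Y" by (rule psubset_card_mono[OF psubset.hyps(1) less])
      ultimately show ?thesis using M by linarith
    qed
  qed
qed

text \<open>The argument is \<open>t - 1\<close> because \<open>h(t) = f(t - 1)\<close>.\<close>

definition nested_sum :: "nat set set \<Rightarrow> 'a::comm_ring_1 \<Rightarrow> nat set \<Rightarrow> 'a" where
  "nested_sum \<B> t Y = (\<Sum>M | nested_on \<B> Y M. (t - 1) ^ (card Y - card M))"

lemma nested_sum_empty:
  assumes "building_set n \<B>"
  shows "nested_sum \<B> t {} = 1"
  using nested_on_empty_iff[OF assms] by (simp add: nested_sum_def)

text \<open>Removal and insertion of the top component are mutually inverse, so the collections on
  \<open>Y\<close> are sorted by the set \<open>b\<close> lost from the support.\<close>

lemma nested_sum_top_component: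
  assumes "building_set n \<B>" "Y \<subseteq> {1..n}" "Y \<noteq> {}"
  shows "nested_sum \<B> t Y
    = (\<Sum>b\<in>Pow (top_component \<B> Y) - {{}}. (t - 1) ^ (card b - 1) * nested_sum \<B> t (Y - b))"
proof -
  let ?C = "top_component \<B> Y"
  note remove = nested_on_remove[OF assms] and ins = nested_on_insert[OF assms]
    and mem = top_component_mem_nested[OF assms]
  have finY: "finite Y" using assms(2) by (rule finite_subset) simp
  have C: "?C \<subseteq> Y" by (rule top_component_subset)
  have finC: "finite ?C" using C finY by (rule finite_subset)
  have "nested_sum \<B> t Y = (\<Sum>(b, M)\<in>Sigma (Pow ?C - {{}}) (\<lambda>b. {M. nested_on \<B> (Y - b) M}).
      (t - 1) ^ (card b - 1) * (t - 1) ^ (card (Y - b) - card M))"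
    unfolding nested_sum_def
  proof (rule sum.reindex_bij_witness[where
        i = "\<lambda>(b, M). insert ?C M" and j = "\<lambda>M. (?C - \<Union>(M - {?C}), M - {?C})"], goal_cases)
    case (1 M)
    then show ?case using mem by (simp add: insert_absorb)
  next
    case (2 M)
    then show ?case using remove(1,3)[of M] by auto
  next
    case (3 p)
    then obtain b M where p: "p = (b, M)" "b \<subseteq> ?C" "b \<noteq> {}" "nested_on \<B> (Y - b) M"
      by (cases p) simp
    then show ?case using ins(1,2)[OF p(2-4)] by simp
  next
    case (4 p)
    then obtain b M where p: "p = (b, M)" "b \<subseteq> ?C" "b \<noteq> {}" "nested_on \<B> (Y - b) M"
      by (cases p) simp
    then show ?case using ins(3)[OF p(2-4)] by simp
  next
    case (5 M)
    then have M: "nested_on \<B> Y M" by simp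
    define b where "b = ?C - \<Union>(M - {?C})"
    note remove = remove[OF M, folded b_def]
    have b: "b \<noteq> {}" "b \<subseteq> Y" "finite b"
      using remove(1) C finC by (auto simp: b_def)
    have cardM: "card M = Suc (card (M - {?C}))"
      using mem[OF M] nested_on_finite[OF M finY] by (intro card.remove)
    have "card (M - {?C}) \<le> card (Y - b)"
      using assms(2) by (intro nested_on_card_le[OF assms(1) _ remove(3)]) blast
    moreover have "card (Y - b) = card Y - card b" "card b \<le> card Y" "card b > 0"
      using b finY by (auto simp: card_Diff_subset card_mono card_gt_0_iff)
    \<comment> \<open>The support loses \<open>card b\<close> elements and the collection one
      member, which leaves the exponent \<open>card b - 1\<close>.\<close>
    ultimately have "card Y - card M = (card b - 1) + (card (Y - b) - card (M - {?C}))"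
      using cardM by linarith
    then show ?case by (simp add: power_add b_def)
  qed
  also have "\<dots> = (\<Sum>b\<in>Pow ?C - {{}}. (t - 1) ^ (card b - 1) * nested_sum \<B> t (Y - b))"
    unfolding nested_sum_def sum_distrib_left using finC finY by (subst sum.Sigma) auto
  finally show ?thesis .
qed

lemma sum_nested_sum:
  assumes "building_set n \<B>" "Y \<subseteq> {1..n}" "Y \<noteq> {}"
  shows "(\<Sum>b\<in>Pow (top_component \<B> Y). block_coeff t (card b) * nested_sum \<B> t (Y - b)) = 0"
proof -
  let ?C = "top_component \<B> Y"
  have "finite Y" using assms(2) by (rule finite_subset) simp
  with top_component_subset have finC: "finite ?C" by (rule finite_subset)
  have "(\<Sum>b\<in>Pow ?C. block_coeff t (card b) * nested_sum \<B> t (Y - b))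
    = nested_sum \<B> t Y + (\<Sum>b\<in>Pow ?C - {{}}. block_coeff t (card b) * nested_sum \<B> t (Y - b))"
    using finC by (subst sum.remove[of _ "{}"]) (auto simp: block_coeff_def)
  also have "(\<Sum>b\<in>Pow ?C - {{}}. block_coeff t (card b) * nested_sum \<B> t (Y - b))
    = - nested_sum \<B> t Y"
    unfolding nested_sum_top_component[OF assms] sum_negf[symmetric]
    using finC by (intro sum.cong) (auto simp: block_coeff_def finite_subset)
  finally show ?thesis by simp
qed

text \<open>This is \<open>H(Y)\<close> of the overview. Each element outside the support
  \<open>Z\<close> may carry a symbol or not, which gives \<open>1 + (t - 1) = t\<close>.\<close>

definition face_sum :: "nat set set \<Rightarrow> 'a::comm_ring_1 \<Rightarrow> nat set \<Rightarrow> 'a" where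
  "face_sum \<B> t Y = (\<Sum>Z\<in>Pow Y. t ^ card (Y - Z) * nested_sum \<B> t Z)"

lemma face_sum_empty:
  assumes "building_set n \<B>"
  shows "face_sum \<B> t {} = 1"
  using nested_sum_empty[OF assms] by (simp add: face_sum_def)

text \<open>The supports are sorted by their part outside the top component and by the part
  \<open>c\<close> of the component that they miss. Summing over \<open>b \<subseteq> c\<close>
  turns \<open>run_coeff\<close> into \<open>block_coeff\<close>, and \<open>sum_nested_sum\<close>
  finishes.\<close>

lemma sum_face_sum:
  fixes t :: "'a::idom"
  assumes "building_set n \<B>" "Y \<subseteq> {1..n}" "Y \<noteq> {}" "t \<noteq> 1"
  shows "(\<Sum>b\<in>Pow (top_component \<B> Y). run_coeff t (card b) * face_sum \<B> t (Y - b)) = 0"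
proof -
  let ?C = "top_component \<B> Y"
  have finY: "finite Y" using assms(2) by (rule finite_subset) simp
  have C: "?C \<subseteq> Y" by (rule top_component_subset)
  have finC: "finite ?C" using C finY by (rule finite_subset)
  have fin_Pow: "finite (Pow c)" if "c \<in> Pow ?C" for c
    using that finC by (auto intro: finite_subset)
  have "(\<Sum>b\<in>Pow ?C. run_coeff t (card b) * face_sum \<B> t (Y - b))
    = (\<Sum>(b, Z)\<in>Sigma (Pow ?C) (\<lambda>b. Pow (Y - b)).
        run_coeff t (card b) * (t ^ card (Y - b - Z) * nested_sum \<B> t Z))"
    unfolding face_sum_def sum_distrib_left using finC finY by (subst sum.Sigma) auto
  also have "\<dots> = (\<Sum>(Z, c, b)\<in>Sigma (Pow (Y - ?C)) (\<lambda>_. Sigma (Pow ?C) Pow).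
        t ^ card (Y - ?C - Z) *
          ((run_coeff t (card b) * t ^ (card c - card b)) * nested_sum \<B> t (?C \<union> Z - c)))"
  \<comment> \<open>A support \<open>Z\<close> avoiding \<open>b\<close> misses at least
    \<open>b\<close> within the component, so \<open>b \<subseteq> ?C - Z\<close>.\<close>
  proof (rule sum.reindex_bij_witness[where
        i = "\<lambda>(Z, c, b). (b, ?C \<union> Z - c)" and j = "\<lambda>(b, Z). (Z - ?C, ?C - Z, b)"], goal_cases)
    case (5 p)
    then obtain b Z where p: "p = (b, Z)" "b \<subseteq> ?C" "Z \<subseteq> Y - b" by (cases p) simp
    have "Y - b - Z = (Y - ?C - (Z - ?C)) \<union> ((?C - Z) - b)" using p C by blast
    moreover have "card \<dots> = card (Y - ?C - (Z - ?C)) + card ((?C - Z) - b)"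
      using finY finC by (intro card_Un_disjoint) auto
    moreover have "card ((?C - Z) - b) = card (?C - Z) - card b"
      using p finC by (intro card_Diff_subset) (auto intro: finite_subset)
    moreover have "?C \<union> (Z - ?C) - (?C - Z) = Z" by blast
    ultimately show ?case using p(1) by (simp add: power_add mult_ac)
  qed (use C in auto)
  also have "\<dots> = (\<Sum>Z\<in>Pow (Y - ?C). \<Sum>(c, b)\<in>Sigma (Pow ?C) Pow.
        t ^ card (Y - ?C - Z) *
          ((run_coeff t (card b) * t ^ (card c - card b)) * nested_sum \<B> t (?C \<union> Z - c)))"
    using finY finC fin_Pow by (intro sum.Sigma[symmetric] ballI finite_SigmaI) auto
  also have "\<dots> = (\<Sum>Z\<in>Pow (Y - ?C). \<Sum>c\<in>Pow ?C. \<Sum>b\<in>Pow c.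
        t ^ card (Y - ?C - Z) *
          ((run_coeff t (card b) * t ^ (card c - card b)) * nested_sum \<B> t (?C \<union> Z - c)))"
    using finC fin_Pow by (intro sum.cong[OF refl] sum.Sigma[symmetric] ballI) auto
  also have "\<dots> = (\<Sum>Z\<in>Pow (Y - ?C). t ^ card (Y - ?C - Z) * (\<Sum>c\<in>Pow ?C.
      (\<Sum>b\<in>Pow c. run_coeff t (card b) * t ^ (card c - card b)) * nested_sum \<B> t (?C \<union> Z - c)))"
    unfolding sum_distrib_left sum_distrib_right ..
  also have "\<dots> = 0"
  proof (rule sum.neutral, rule ballI)
    fix Z assume Z: "Z \<in> Pow (Y - ?C)"
    have top: "top_component \<B> (?C \<union> Z) = ?C"
      using Z by (intro top_component_restrict[OF assms(1-3)]) auto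
    have sub: "?C \<union> Z \<subseteq> {1..n}" "?C \<union> Z \<noteq> {}"
      using Z C assms(2) Max_in_top_component[OF assms(1-3)] by auto
    have "(\<Sum>c\<in>Pow ?C. (\<Sum>b\<in>Pow c. run_coeff t (card b) * t ^ (card c - card b))
          * nested_sum \<B> t (?C \<union> Z - c))
       = (\<Sum>c\<in>Pow ?C. block_coeff t (card c) * nested_sum \<B> t (?C \<union> Z - c))"
    proof (rule sum.cong)
      fix c assume "c \<in> Pow ?C"
      then have "finite c" using finC by (auto intro: finite_subset)
      then show "(\<Sum>b\<in>Pow c. run_coeff t (card b) * t ^ (card c - card b))
          * nested_sum \<B> t (?C \<union> Z - c) = block_coeff t (card c) * nested_sum \<B> t (?C \<union> Z - c)"
        by (simp only: sum_run_coeff[OF _ assms(4)])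
    qed simp
    also have "\<dots> = 0" using sum_nested_sum[OF assms(1) sub, of t] unfolding top .
    finally show "t ^ card (Y - ?C - Z) * (\<Sum>c\<in>Pow ?C.
        (\<Sum>b\<in>Pow c. run_coeff t (card b) * t ^ (card c - card b))
          * nested_sum \<B> t (?C \<union> Z - c)) = 0" by simp
  qed
  finally show ?thesis .
qed

text \<open>The term \<open>b = {}\<close> has coefficient 1 and all others concern proper subsets,
  so the recursion can be solved for the value at \<open>Y\<close>.\<close>

lemma run_recursion_unique:
  fixes f g :: "nat set \<Rightarrow> 'a::comm_ring_1"
  assumes "finite Y" "f {} = g {}"
    and f: "\<And>Z. Z \<subseteq> Y \<Longrightarrow> Z \<noteq> {} \<Longrightarrow>
      (\<Sum>b\<in>Pow (top_component \<B> Z). run_coeff t (card b) * f (Z - b)) = 0"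
    and g: "\<And>Z. Z \<subseteq> Y \<Longrightarrow> Z \<noteq> {} \<Longrightarrow>
      (\<Sum>b\<in>Pow (top_component \<B> Z). run_coeff t (card b) * g (Z - b)) = 0"
  shows "f Y = g Y"
  using assms(1) f g
proof (induction Y rule: finite_psubset_induct)
  case (psubset Y)
  show ?case
  proof (cases "Y = {}")
    case False
    let ?C = "top_component \<B> Y"
    have C: "?C \<subseteq> Y" by (rule top_component_subset)
    with psubset.hyps(1) have finC: "finite ?C" by (simp add: finite_subset)
    have split: "(\<Sum>b\<in>Pow ?C. run_coeff t (card b) * k (Y - b))
        = k Y + (\<Sum>b\<in>Pow ?C - {{}}. run_coeff t (card b) * k (Y - b))" for k :: "nat set \<Rightarrow> 'a"
      using finC by (subst sum.remove[of _ "{}"]) auto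
    have "f (Y - b) = g (Y - b)" if "b \<in> Pow ?C - {{}}" for b
    proof (rule psubset.IH)
      show "Y - b \<subset> Y" using that C by blast
    qed (use psubset.prems in \<open>meson Diff_subset order_trans\<close>)+
    then have "(\<Sum>b\<in>Pow ?C - {{}}. run_coeff t (card b) * f (Y - b))
        = (\<Sum>b\<in>Pow ?C - {{}}. run_coeff t (card b) * g (Y - b))" by simp
    then have "f Y + (\<Sum>b\<in>Pow ?C - {{}}. run_coeff t (card b) * f (Y - b))
        = g Y + (\<Sum>b\<in>Pow ?C - {{}}. run_coeff t (card b) * f (Y - b))"
      using psubset.prems[of Y] False split[of f] split[of g] by simp
    then show ?thesis by simp
  qed (simp add: assms(2))
qed

lemma word_sum_eq_face_sum:
  fixes t :: "'a::idom"
  assumes "chordal_building_set n \<B>" "Y \<subseteq> {1..n}" "t \<noteq> 1"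
  shows "word_sum \<B> t Y = face_sum \<B> t Y"
proof (rule run_recursion_unique)
  have building: "building_set n \<B>" using assms(1) by (simp add: chordal_building_set_def)
  show "finite Y" using assms(2) by (rule finite_subset) simp
  show "word_sum \<B> t {} = face_sum \<B> t {}"
    by (simp add: word_sum_empty face_sum_empty[OF building])
  fix Z assume Z: "Z \<subseteq> Y" "Z \<noteq> {}"
  then have sub: "Z \<subseteq> {1..n}" using assms(2) by order
  show "(\<Sum>b\<in>Pow (top_component \<B> Z). run_coeff t (card b) * word_sum \<B> t (Z - b)) = 0"
    by (rule sum_word_sum[OF assms(1) sub Z(2)])
  show "(\<Sum>b\<in>Pow (top_component \<B> Z). run_coeff t (card b) * face_sum \<B> t (Z - b)) = 0"
    by (rule sum_face_sum[OF building sub Z(2) assms(3)])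
qed


section \<open>Extended nested collections\<close>

definition ext_collection :: "nat set set \<Rightarrow> nat set \<Rightarrow> ext_element set" where
  "ext_collection M S = Bset ` M \<union> Sym ` S"

lemma Bset_ext_collection [simp]: "Bset I \<in> ext_collection M S \<longleftrightarrow> I \<in> M"
  and Sym_ext_collection [simp]: "Sym i \<in> ext_collection M S \<longleftrightarrow> i \<in> S"
  by (auto simp: ext_collection_def)

lemma ext_collection_parts: "ext_collection {I. Bset I \<in> N} {i. Sym i \<in> N} = N"
proof (rule set_eqI)
  fix x show "x \<in> ext_collection {I. Bset I \<in> N} {i. Sym i \<in> N} \<longleftrightarrow> x \<in> N" by (cases x) simp_all
qed

lemma card_ext_collection:
  assumes "finite M" "finite S"
  shows "card (ext_collection M S) = card M + card S"
proof -
  have "card (Bset ` M \<union> Sym ` S) = card (Bset ` M) + card (Sym ` S)"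
    using assms by (intro card_Un_disjoint) auto
  then show ?thesis by (simp add: ext_collection_def card_image inj_on_def)
qed

text \<open>Symbols interact with the sets only through the support \<open>\<Union>M\<close>, so
  they form an arbitrary subset of its complement.\<close>

lemma extended_nested_collection_iff:
  assumes "building_set n \<B>"
  shows "extended_nested_collection n \<B> (ext_collection M S) \<longleftrightarrow>
    nested_on \<B> (\<Union>M) M \<and> \<Union>M \<subseteq> {1..n} \<and> S \<subseteq> {1..n} - \<Union>M"
proof -
  have mem: "(\<forall>I. I \<in> M \<longrightarrow> I \<in> \<B>) \<longleftrightarrow> M \<subseteq> \<B>"
    and sym: "(\<forall>i. i \<in> S \<longrightarrow> i \<in> {1..n}) \<longleftrightarrow> S \<subseteq> {1..n}"
    and disj: "(\<forall>i I. i \<in> S \<and> I \<in> M \<longrightarrow> i \<notin> I) \<longleftrightarrow> S \<inter> \<Union>M = {}"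
    and diff: "S \<subseteq> {1..n} - \<Union>M \<longleftrightarrow> S \<subseteq> {1..n} \<and> S \<inter> \<Union>M = {}"
    and pairs: "(\<forall>I J. I \<in> M \<and> J \<in> M \<longrightarrow> I \<subseteq> J \<or> J \<subseteq> I \<or> I \<inter> J = {})
      \<longleftrightarrow> (\<forall>I\<in>M. \<forall>J\<in>M. I \<subseteq> J \<or> J \<subseteq> I \<or> I \<inter> J = {})"
    and families: "(\<forall>K. K \<subseteq> M \<and> finite K \<and> card K \<ge> 2 \<and> pairwise disjnt K \<longrightarrow> \<Union>K \<notin> \<B>)
      \<longleftrightarrow> (\<forall>K\<subseteq>M. finite K \<and> card K \<ge> 2 \<and> pairwise disjnt K \<longrightarrow> \<Union>K \<notin> \<B>)"
    by blast+
  have "\<Union>M \<subseteq> {1..n}" if "M \<subseteq> \<B>"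
    using that assms unfolding building_set_def by (meson Sup_least subsetD)
  then show ?thesis
    unfolding extended_nested_collection_def nested_on_def Bset_ext_collection Sym_ext_collection
      Collect_mem_eq mem sym disj diff pairs families
    by (cases "M \<subseteq> \<B>") (simp_all only: simp_thms conj_ac)
qed

text \<open>The support \<open>Z\<close> is determined by \<open>M\<close>; recording it allows
  summation over one support at a time.\<close>

definition ext_data :: "nat \<Rightarrow> nat set set \<Rightarrow> (nat set \<times> nat set set \<times> nat set) set" where
  "ext_data n \<B> = Sigma (Pow {1..n}) (\<lambda>Z. {M. nested_on \<B> Z M} \<times> Pow ({1..n} - Z))"

lemma finite_ext_data: "finite (ext_data n \<B>)"
  unfolding ext_data_def
proof (intro finite_SigmaI finite_cartesian_product finite_nested_on)
  show "finite Z" if "Z \<in> Pow {1..n}" for Z :: "nat set"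
    using that by (auto intro: finite_subset)
qed auto

lemma bij_betw_ext_collection:
  assumes "building_set n \<B>"
  shows "bij_betw (\<lambda>(Z, M, S). ext_collection M S) (ext_data n \<B>)
    {N. extended_nested_collection n \<B> N}"
proof (rule bij_betwI[where
      g = "\<lambda>N. (\<Union>{I. Bset I \<in> N}, {I. Bset I \<in> N}, {i. Sym i \<in> N})"])
  show "(\<lambda>(Z, M, S). ext_collection M S) \<in> ext_data n \<B> \<rightarrow> {N. extended_nested_collection n \<B> N}"
  proof
    fix p assume "p \<in> ext_data n \<B>"
    then obtain Z M S where p: "p = (Z, M, S)" "Z \<subseteq> {1..n}" "nested_on \<B> Z M" "S \<subseteq> {1..n} - Z"
      unfolding ext_data_def by (cases p) auto
    then have "\<Union>M = Z" by (simp add: nested_on_def)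
    then show "(case p of (Z, M, S) \<Rightarrow> ext_collection M S) \<in> {N. extended_nested_collection n \<B> N}"
      using p extended_nested_collection_iff[OF assms] by simp
  qed
  show "(\<lambda>N. (\<Union>{I. Bset I \<in> N}, {I. Bset I \<in> N}, {i. Sym i \<in> N}))
      \<in> {N. extended_nested_collection n \<B> N} \<rightarrow> ext_data n \<B>"
  proof
    fix N assume "N \<in> {N. extended_nested_collection n \<B> N}"
    then show "(\<Union>{I. Bset I \<in> N}, {I. Bset I \<in> N}, {i. Sym i \<in> N}) \<in> ext_data n \<B>"
      using extended_nested_collection_iff[OF assms, of "{I. Bset I \<in> N}" "{i. Sym i \<in> N}"]
      unfolding ext_collection_parts ext_data_def by simp
  qed
  show "(\<lambda>N. (\<Union>{I. Bset I \<in> N}, {I. Bset I \<in> N}, {i. Sym i \<in> N}))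
      ((\<lambda>(Z, M, S). ext_collection M S) p) = p" if "p \<in> ext_data n \<B>" for p
    using that by (cases p) (simp add: ext_data_def nested_on_def)
  show "(\<lambda>(Z, M, S). ext_collection M S)
      ((\<lambda>N. (\<Union>{I. Bset I \<in> N}, {I. Bset I \<in> N}, {i. Sym i \<in> N})) N) = N" for N
    by (simp add: ext_collection_parts)
qed

lemma card_ext_data:
  assumes "building_set n \<B>" "(Z, M, S) \<in> ext_data n \<B>"
  shows "card (ext_collection M S) \<le> n"
    and "n - card (ext_collection M S) = (card Z - card M) + (card ({1..n} - Z) - card S)"
proof -
  have p: "Z \<subseteq> {1..n}" "nested_on \<B> Z M" "S \<subseteq> {1..n} - Z"
    using assms(2) by (auto simp: ext_data_def)
  have fin: "finite Z" "finite S"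
    using p(1,3) by (auto intro: finite_subset)
  have "card M \<le> card Z" by (rule nested_on_card_le[OF assms(1) p(1,2)])
  moreover have "card S \<le> card ({1..n} - Z)" using p(3) by (intro card_mono) auto
  moreover have "card ({1..n} - Z) = n - card Z" "card Z \<le> n"
    using card_Diff_subset[OF fin(1) p(1)] card_mono[OF _ p(1)] by simp_all
  moreover have "card (ext_collection M S) = card M + card S"
    using nested_on_finite[OF p(2) fin(1)] fin(2) by (rule card_ext_collection)
  ultimately show "card (ext_collection M S) \<le> n"
    and "n - card (ext_collection M S) = (card Z - card M) + (card ({1..n} - Z) - card S)"
    by linarith+
qed

lemma sum_extended_nested_collection:
  assumes "building_set n \<B>"
  shows "(\<Sum>N | extended_nested_collection n \<B> N. (t - 1) ^ (n - card N)) = face_sum \<B> t {1..n}"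
proof -
  let ?A = "\<lambda>Z. {1..n} - Z"
  have "(\<Sum>N | extended_nested_collection n \<B> N. (t - 1) ^ (n - card N))
    = (\<Sum>(Z, M, S)\<in>ext_data n \<B>. (t - 1) ^ (n - card (ext_collection M S)))"
    by (subst sum.reindex_bij_betw[OF bij_betw_ext_collection[OF assms], symmetric])
      (simp add: case_prod_unfold)
  also have "\<dots> = (\<Sum>(Z, M, S)\<in>ext_data n \<B>.
      (t - 1) ^ (card Z - card M) * (t - 1) ^ (card (?A Z) - card S))"
    using card_ext_data(2)[OF assms] by (intro sum.cong) (auto simp: power_add)
  also have "\<dots> = (\<Sum>Z\<in>Pow {1..n}. \<Sum>(M, S)\<in>{M. nested_on \<B> Z M} \<times> Pow (?A Z).
      (t - 1) ^ (card Z - card M) * (t - 1) ^ (card (?A Z) - card S))"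
    unfolding ext_data_def
    by (intro sum.Sigma[symmetric] ballI finite_cartesian_product finite_nested_on)
      (auto intro: finite_subset)
  also have "\<dots> = (\<Sum>Z\<in>Pow {1..n}. t ^ card (?A Z) * nested_sum \<B> t Z)"
  proof (rule sum.cong)
    fix Z
    have "(\<Sum>S\<in>Pow (?A Z). (t - 1) ^ (card (?A Z) - card S)) = t ^ card (?A Z)"
      using sum_Pow_binomial[of "?A Z" 1 "t - 1"] by simp
    then show "(\<Sum>(M, S)\<in>{M. nested_on \<B> Z M} \<times> Pow (?A Z).
        (t - 1) ^ (card Z - card M) * (t - 1) ^ (card (?A Z) - card S))
      = t ^ card (?A Z) * nested_sum \<B> t Z"
      unfolding nested_sum_def sum_product[symmetric] sum.cartesian_product[symmetric]
      by (simp add: mult.commute)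
  qed simp
  finally show ?thesis by (simp add: face_sum_def)
qed

section \<open>From counting collections and faces to the h-polynomial\<close>

lemma pcompose_monom: "pcompose (monom c i) p = smult c (p ^ i)"
  by (induction i) (simp_all add: monom_0 monom_Suc pcompose_pCons)

lemma h_polynomial_nested:
  assumes "building_set n \<B>"
  shows "h_polynomial n (nested_f_vector n \<B>) = face_sum \<B> [:0, 1:] {1..n}"
proof -
  let ?E = "{N. extended_nested_collection n \<B> N}"
  let ?x = "[:-1, 1:] :: int poly"
  have fin: "finite ?E"
    using bij_betw_finite[OF bij_betw_ext_collection[OF assms]] finite_ext_data by blast
  \<comment> \<open>With truncated subtraction, this bound is what makes
    \<open>n - card N = i\<close> equivalent to \<open>card N = n - i\<close> for
    \<open>i \<le> n\<close>.\<close>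
  have le: "card N \<le> n" if "N \<in> ?E" for N
  proof -
    have "N \<in> (\<lambda>(Z, M, S). ext_collection M S) ` ext_data n \<B>"
      using that bij_betw_imp_surj_on[OF bij_betw_ext_collection[OF assms]] by simp
    then obtain Z M S where "(Z, M, S) \<in> ext_data n \<B>" "N = ext_collection M S"
      by auto
    then show ?thesis using card_ext_data(1)[OF assms] by simp
  qed
  have "h_polynomial n (nested_f_vector n \<B>)
    = (\<Sum>i\<le>n. of_nat (nested_f_vector n \<B> i) * ?x ^ i)"
    by (simp add: h_polynomial_def f_polynomial_def pcompose_sum pcompose_monom of_nat_poly)
  also have "\<dots> = (\<Sum>i\<le>n. \<Sum>N\<in>{N \<in> ?E. n - card N = i}. ?x ^ (n - card N))"
  proof (rule sum.cong)
    fix i assume "i \<in> {..n}"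
    then have "{N. extended_nested_collection n \<B> N \<and> card N = n - i} = {N \<in> ?E. n - card N = i}"
      using le by auto
    then show "of_nat (nested_f_vector n \<B> i) * ?x ^ i
        = (\<Sum>N\<in>{N \<in> ?E. n - card N = i}. ?x ^ (n - card N))"
      by (simp add: nested_f_vector_def)
  qed simp
  also have "\<dots> = (\<Sum>N\<in>?E. ?x ^ (n - card N))"
    using fin by (intro sum.group) auto
  also have "?x = [:0, 1:] - 1" by (simp add: one_pCons)
  also have "(\<Sum>N\<in>?E. ([:0, 1:] - 1) ^ (n - card N)) = face_sum \<B> [:0, 1 :: int:] {1..n}"
    by (rule sum_extended_nested_collection[OF assms])
  finally show ?thesis .
qed

lemma face_number_extended_nestohedron:
  assumes "is_extended_nestohedron n \<B> P" "i \<le> n"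
  shows "face_number P i = nested_f_vector n \<B> i"
proof -
  let ?E = "{N. extended_nested_collection n \<B> N}"
  obtain \<Phi> where \<Phi>: "bij_betw \<Phi> ?E {F. F face_of P \<and> F \<noteq> {}}"
    and dim: "\<forall>N. extended_nested_collection n \<B> N \<longrightarrow> aff_dim (\<Phi> N) = int n - int (card N)"
    using assms(1) unfolding is_extended_nestohedron_def by - (elim conjE exE, rule that)
  have iff: "aff_dim (\<Phi> N) = int i \<longleftrightarrow> card N = n - i" if "N \<in> ?E" for N
    using dim that assms(2) by auto
  \<comment> \<open>The empty face has dimension -1, so excluding it from the range of
    \<open>\<Phi>\<close> loses nothing.\<close>
  have "{F. F face_of P \<and> aff_dim F = int i} = {F \<in> \<Phi> ` ?E. aff_dim F = int i}"
    unfolding bij_betw_imp_surj_on[OF \<Phi>] by auto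
  also have "\<dots> = \<Phi> ` {N \<in> ?E. card N = n - i}"
    using iff by auto
  finally have "face_number P i = card (\<Phi> ` {N \<in> ?E. card N = n - i})"
    by (simp add: face_number_def)
  also have "\<dots> = card {N \<in> ?E. card N = n - i}"
    using bij_betw_imp_inj_on[OF \<Phi>] by (intro card_image) (auto intro: inj_on_subset)
  finally show ?thesis by (simp add: nested_f_vector_def)
qed

lemma h_polynomial_cong:
  assumes "\<And>i. i \<le> d \<Longrightarrow> f i = g i"
  shows "h_polynomial d f = h_polynomial d g"
  using assms by (simp add: h_polynomial_def f_polynomial_def)


section \<open>The gamma-polynomial\<close>

definition rev_words :: "nat \<Rightarrow> nat set set \<Rightarrow> nat list set" where
  "rev_words n \<B> =
     {v. rev_partial_permutation \<B> v \<and> set v = {1..n} \<and> \<not> double_descent (rev v)}"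

lemma final_descent_snoc:
  "final_descent (w @ [a]) \<longleftrightarrow> w \<noteq> [] \<and> a < last w"
  by (cases w rule: rev_cases) (auto simp: final_descent_def nth_append)

text \<open>A missing letter of \<open>{1..n}\<close> would be appended together with
  \<open>n + 1\<close>, and a decreasing tail of length at least two ends in a descent.\<close>

lemma append_decreasing_hat_imp:
  assumes "set w \<subseteq> {1..n}" "append_decreasing n w \<in> hat_permutations (n + 1)"
  shows "set w = {1..n}"
proof (rule ccontr)
  assume "set w \<noteq> {1..n}"
  then obtain x where x: "x \<in> {1..n}" "x \<notin> set w" using assms(1) by blast
  let ?R = "{1..n + 1} - set w"
  have R: "x \<in> ?R" "n + 1 \<in> ?R" using x assms(1) by auto
  have set_l: "set (sorted_list_of_set ?R) = ?R" by simp
  obtain a b l where l: "sorted_list_of_set ?R = a # b # l"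
  proof (cases "sorted_list_of_set ?R" rule: remdups_adj.cases)
    case 1
    then show ?thesis using set_l R(1) by (metis empty_iff list.set(1))
  next
    case (2 a)
    then have "?R = {a}" using set_l by simp
    then have "x = n + 1" using R by (metis singletonD)
    then show ?thesis using x by simp
  next
    case (3 a b l)
    then show ?thesis using that by blast
  qed
  have "sorted_wrt (<) (a # b # l)" unfolding l[symmetric] by (rule strict_sorted_list_of_set)
  then have "a < b" by simp
  then have "final_descent (append_decreasing n w)"
    using final_descent_snoc[of "w @ rev l @ [b]" a] unfolding append_decreasing_def l by simp
  then show False using assms(2) by (simp add: hat_permutations_def)
qed

lemma append_decreasing_full:
  assumes "set w = {1..n}"
  shows "append_decreasing n w = rev (Suc n # rev w)"
proof -
  have "{1..n + 1} - set w = {Suc n}" using assms by auto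
  then show ?thesis by (simp add: append_decreasing_def)
qed

text \<open>The word uses all of \<open>{1..n}\<close>, so only \<open>n + 1\<close> is appended;
  being larger than everything before it, it creates no descent.\<close>

lemma hat_permutations_Int_extended:
  "hat_permutations (n + 1) \<inter> extended_B_permutations n \<B>
    = (\<lambda>v. rev (Suc n # v)) ` rev_words n \<B>"
proof (intro equalityI subsetI)
  fix u assume u: "u \<in> hat_permutations (n + 1) \<inter> extended_B_permutations n \<B>"
  then obtain w where w: "u = append_decreasing n w" "partial_permutation n \<B> w"
    by (auto simp: extended_B_permutations_def)
  then have rp: "rev_partial_permutation \<B> (rev w)" "set w \<subseteq> {1..n}"
    by (simp_all add: partial_permutation_iff)
  have set_w: "set w = {1..n}"
    using append_decreasing_hat_imp[OF rp(2)] u w(1) by simp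
  have u_eq: "u = rev (Suc n # rev w)" unfolding w(1) by (rule append_decreasing_full[OF set_w])
  have "rev w \<noteq> [] \<Longrightarrow> hd (rev w) < Suc n"
    using set_w hd_in_set[of "rev w"] by auto
  then have "double_descent u \<longleftrightarrow> double_descent w"
    using double_descent_rev_larger[of "rev w" "Suc n"] unfolding u_eq by simp
  then have "rev w \<in> rev_words n \<B>"
    using u rp(1) set_w by (simp add: rev_words_def hat_permutations_def)
  then show "u \<in> (\<lambda>v. rev (Suc n # v)) ` rev_words n \<B>" using u_eq by blast
next
  fix u assume "u \<in> (\<lambda>v. rev (Suc n # v)) ` rev_words n \<B>"
  then obtain v where v: "u = rev (Suc n # v)" "rev_partial_permutation \<B> v" "set v = {1..n}"
    "\<not> double_descent (rev v)" by (auto simp: rev_words_def)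
  have hd: "v \<noteq> [] \<Longrightarrow> hd v < Suc n" using v(3) hd_in_set[of v] by auto
  then have "\<not> double_descent u" using double_descent_rev_larger[of v "Suc n"] v(1,4) by simp
  moreover have "\<not> final_descent u"
    using hd unfolding v(1) rev.simps final_descent_snoc by (auto simp: last_rev)
  moreover have "u \<in> permutations_of_set {1..n + 1}"
    using v(1,3) rev_partial_permutation_distinct[OF v(2)] by (auto simp: permutations_of_set_def)
  moreover have "u = append_decreasing n (rev v)"
    using append_decreasing_full[of "rev v" n] v(1,3) by simp
  moreover have "partial_permutation n \<B> (rev v)"
    using v(2,3) by (simp add: partial_permutation_iff)
  ultimately show "u \<in> hat_permutations (n + 1) \<inter> extended_B_permutations n \<B>"
    by (auto simp: hat_permutations_def extended_B_permutations_def)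
qed

lemma gamma_expansion_sum:
  "gamma_expansion d (\<Sum>x\<in>A. g x) = (\<Sum>x\<in>A. gamma_expansion d (g x))"
  unfolding gamma_expansion_def coeff_sum smult_sum by (rule sum.swap)

lemma gamma_expansion_monom:
  assumes "k \<le> d div 2"
  shows "gamma_expansion d (monom 1 k) = monom 1 k * [:1, 1:] ^ (d - 2 * k)"
proof -
  have "gamma_expansion d (monom 1 k)
    = (\<Sum>i\<le>d div 2. if i = k then monom 1 k * [:1, 1:] ^ (d - 2 * k) else 0)"
    unfolding gamma_expansion_def by (intro sum.cong) auto
  then show ?thesis using assms by simp
qed

text \<open>By \<open>run_weight_eq\<close> a word without double descents has as weight the
  gamma-expansion of \<open>t^des\<close>, and \<open>2 * des \<le> n\<close> bounds the
  degree.\<close>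

lemma gamma_polynomial_word_sum:
  defines "G n \<B> \<equiv> \<Sum>w\<in>hat_permutations (n + 1) \<inter> extended_B_permutations n \<B>. monom 1 (des w)"
  shows "is_gamma_polynomial n (word_sum \<B> [:0, 1:] {1..n}) (G n \<B>)"
proof -
  have hd: "v \<noteq> [] \<Longrightarrow> hd v < Suc n" if "v \<in> rev_words n \<B>" for v
    using that hd_in_set[of v] by (auto simp: rev_words_def)
  have G: "G n \<B> = (\<Sum>v\<in>rev_words n \<B>. monom 1 (des (rev v)))"
    unfolding G_def hat_permutations_Int_extended
  proof (subst sum.reindex)
    show "inj_on (\<lambda>v. rev (Suc n # v)) (rev_words n \<B>)" by (rule inj_onI) simp
    show "sum ((\<lambda>w. monom 1 (des w)) \<circ> (\<lambda>v. rev (Suc n # v))) (rev_words n \<B>)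
        = (\<Sum>v\<in>rev_words n \<B>. monom 1 (des (rev v)))"
      using hd by (intro sum.cong) (auto simp: des_rev_larger simp del: rev.simps)
  qed
  have weight: "des (rev v) \<le> n div 2"
    "run_weight [:0, 1:] v = monom 1 (des (rev v)) * [:1, 1::int:] ^ (n - 2 * des (rev v))"
    if "v \<in> rev_words n \<B>" for v
  proof -
    have v: "distinct v" "\<not> double_descent (rev v)" "set v = {1..n}"
      using that rev_partial_permutation_distinct by (auto simp: rev_words_def)
    then have "length v = n" using distinct_card[of v] by simp
    then show "des (rev v) \<le> n div 2"
      "run_weight [:0, 1:] v = monom 1 (des (rev v)) * [:1, 1::int:] ^ (n - 2 * des (rev v))"
      using run_weight_eq[OF v(1), of "[:0, 1::int:]"] v(2)
      by (auto simp: monom_altdef one_pCons)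
  qed
  have "word_sum \<B> [:0, 1:] {1..n} = (\<Sum>v\<in>rev_words n \<B>. run_weight [:0, 1:] v)"
    unfolding word_sum_def
  proof (rule sum.mono_neutral_right)
    show "\<forall>v\<in>{v. rev_partial_permutation \<B> v \<and> set v = {1..n}} - rev_words n \<B>.
        run_weight [:0, 1:] v = 0"
      using run_weight_eq rev_partial_permutation_distinct by (auto simp: rev_words_def)
  qed (auto simp: rev_words_def)
  also have "\<dots> = gamma_expansion n (G n \<B>)"
    unfolding G gamma_expansion_sum using weight by (intro sum.cong) (auto simp: gamma_expansion_monom)
  finally have "word_sum \<B> [:0, 1:] {1..n} = gamma_expansion n (G n \<B>)" .
  moreover have "degree (G n \<B>) \<le> n div 2"
    unfolding G
  proof (rule degree_sum_le)
    show "finite (rev_words n \<B>)"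
      by (rule finite_subset[OF _ finite_rev_partial_permutations[of \<B> "{1..n}"]]) (auto simp: rev_words_def)
    show "degree (monom (1::int) (des (rev v))) \<le> n div 2" if "v \<in> rev_words n \<B>" for v
      using weight(1)[OF that] by (rule order_trans[OF degree_monom_le])
  qed
  ultimately show ?thesis by (simp add: is_gamma_polynomial_def)
qed

theorem theorem6p34:
  fixes n :: nat and \<B> :: "nat set set" and P :: "'a::euclidean_space set"
  assumes "connected_building_set n \<B>"
    and "chordal_building_set n \<B>"
  shows "let G = (\<Sum>w \<in> hat_permutations (n + 1) \<inter> extended_B_permutations n \<B>. monom 1 (des w))
    in is_gamma_polynomial n (h_polynomial n (nested_f_vector n \<B>)) G \<and>
       (is_extended_nestohedron n \<B> P \<longrightarrow>
          is_gamma_polynomial n (h_polynomial n (face_number P)) G)"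
proof -
  have "building_set n \<B>" using assms(2) by (simp add: chordal_building_set_def)
  then have "h_polynomial n (nested_f_vector n \<B>) = face_sum \<B> [:0, 1:] {1..n}"
    by (rule h_polynomial_nested)
  \<comment> \<open>The recursion is used at the indeterminate \<open>[:0, 1:]\<close>, which
    differs from 1 in the domain of integer polynomials.\<close>
  also have "\<dots> = word_sum \<B> [:0, 1:] {1..n}"
    by (rule word_sum_eq_face_sum[OF assms(2) order_refl, symmetric]) (simp add: one_pCons)
  finally have "is_gamma_polynomial n (h_polynomial n (nested_f_vector n \<B>))
      (\<Sum>w \<in> hat_permutations (n + 1) \<inter> extended_B_permutations n \<B>. monom 1 (des w))"
    using gamma_polynomial_word_sum[of n \<B>] by simp
  moreover have "h_polynomial n (face_number P) = h_polynomial n (nested_f_vector n \<B>)"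
    if "is_extended_nestohedron n \<B> P"
    using face_number_extended_nestohedron[OF that] by (rule h_polynomial_cong)
  ultimately show ?thesis by (simp add: Let_def)
qed

end
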